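(* Let $\alpha = (\alpha_j)_{j\ge 0}$ be an $O$-sequence. For all nonnegative integers $j$, $$(\alpha_1+j)\,\alpha_j\ \ge\ (j+1)\,\alpha_{j+1}.$$
   Context: Given positive integers $a$ and $d$, the $d$-th Macaulay representation of $a$ is the unique expansion $a = \binom{a_d}{d}+\binom{a_{d-1}}{d-1}+\cdots+\binom{a_t}{t}$ with $a_d>a_{d-1}>\cdots>a_t\ge t\ge 1$. Define $a^{\langle d\rangle} = \binom{a_d+1}{d+1}+\binom{a_{d-1}+1}{d}+\cdots+\binom{a_t+1}{t+1}$, and set $0^{\langle d\rangle}=0$. A sequence of nonnegative integers $(h_j)_{j\ge 0}$ is an $O$-sequence if $h_0=1$ and $h_{j+1}\le h_j^{\langle j\rangle}$ for all $j\ge 1$. By Macaulay's theorem, these are exactly the Hilbert functions $h_j=\dim_K [R/I]_j$ of standard graded $K$-algebras $R/I$. A finite sequence $(\alpha_0,\ldots,\alpha_t)$ is regarded as an infinite one by setting $\alpha_j=0$ for $j>t$. *)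

theory Defs
  imports Complex_Main
begin

text \<open>
  The entry \<open>c i\<close> is the number \<open>a\<^sub>i\<close> of the expansion
  \<open>a = (a\<^sub>d choose d) + \<dots> + (a\<^sub>t choose t)\<close>, so the bottom of a binomial
  coefficient is the index of its top.  Values of \<open>c\<close> outside \<open>{t..d}\<close> are irrelevant.
\<close>

definition macaulay_rep :: "nat \<Rightarrow> nat \<Rightarrow> nat \<Rightarrow> (nat \<Rightarrow> nat) \<Rightarrow> bool" where
  "macaulay_rep a d t c \<longleftrightarrow>
     1 \<le> t \<and> t \<le> d \<and> t \<le> c t \<and> strict_mono_on {t..d} c \<and>
     a = (\<Sum>i = t..d. c i choose i)"

text \<open>
  \<open>macaulay_up a d\<close> is \<open>a\<^bsup>\<langle>d\<rangle>\<^esup>\<close>.  It is only meaningful for \<open>d \<ge> 1\<close>, where the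
  representation of a positive \<open>a\<close> exists and is unique on \<open>{t..d}\<close>.
\<close>

definition macaulay_up :: "nat \<Rightarrow> nat \<Rightarrow> nat" where
  "macaulay_up a d =
     (if a = 0 then 0
      else (THE b. \<exists>t c. macaulay_rep a d t c \<and>
                         b = (\<Sum>i = t..d. (c i + 1) choose (i + 1))))"

definition O_sequence :: "(nat \<Rightarrow> nat) \<Rightarrow> bool" where
  "O_sequence h \<longleftrightarrow> h 0 = 1 \<and> (\<forall>j\<ge>1. h (j + 1) \<le> macaulay_up (h j) j)"

end

theory Submission
  imports Defs
begin

text \<open>
  Write \<open>a = \<Sum> (c i choose i)\<close> for the \<open>d\<close>-th Macaulay representation.  Since
  \<open>(i + 1) (c i + 1 choose i + 1) = (c i + 1) (c i choose i)\<close>, induction on \<open>d\<close> gives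
  \<open>(d + 1) a\<^bsup>\<langle>d\<rangle>\<^esup> \<le> (c d + 2) a\<close>, with \<open>c d + 1\<close> instead of \<open>c d + 2\<close> if there is only one
  summand; the induction step also uses \<open>a\<^bsup>\<langle>d\<rangle>\<^esup> - a = \<Sum> (c i choose i + 1) \<le> (c d + 1 choose d + 1)\<close>.
  If \<open>a \<le> (n + d - 1 choose d)\<close>, then \<open>c d + 2 \<le> n + d\<close> unless equality holds, in which case there
  is only one summand; hence \<open>(d + 1) a\<^bsup>\<langle>d\<rangle>\<^esup> \<le> (n + d) a\<close> always.  With \<open>n = \<alpha> 1\<close> this
  inequality also propagates the bound \<open>\<alpha> j \<le> (n + j - 1 choose j)\<close> from \<open>j\<close> to \<open>j + 1\<close>.
\<close>

section \<open>Building representations from the bottom index upwards\<close>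

lemma macaulay_rep_single:
  "macaulay_rep a d d c \<longleftrightarrow> 1 \<le> d \<and> d \<le> c d \<and> a = c d choose d"
  by (auto simp: macaulay_rep_def strict_mono_on_def)

lemma strict_mono_on_atLeastAtMost_Suc:
  fixes c :: "nat \<Rightarrow> nat"
  assumes "t \<le> d"
  shows "strict_mono_on {t..Suc d} c \<longleftrightarrow> strict_mono_on {t..d} c \<and> c d < c (Suc d)"
proof
  assume "strict_mono_on {t..Suc d} c"
  then show "strict_mono_on {t..d} c \<and> c d < c (Suc d)"
    using assms by (auto simp: strict_mono_on_def)
next
  assume *: "strict_mono_on {t..d} c \<and> c d < c (Suc d)"
  show "strict_mono_on {t..Suc d} c"
  proof (rule strict_mono_onI)
    fix r s assume rs: "r \<in> {t..Suc d}" "s \<in> {t..Suc d}" "r < s"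
    have "c r \<le> c d" if "s = Suc d"
      using * rs that assms by (cases "r = d") (auto simp: strict_mono_on_def intro: less_imp_le)
    then show "c r < c s"
      using * rs by (cases "s = Suc d") (auto simp: strict_mono_on_def)
  qed
qed

lemma macaulay_rep_Suc:
  assumes "t \<le> d"
  shows "macaulay_rep a (Suc d) t c \<longleftrightarrow>
    c d < c (Suc d) \<and> (\<exists>r. macaulay_rep r d t c \<and> a = r + (c (Suc d) choose Suc d))"
  using assms by (auto simp: macaulay_rep_def strict_mono_on_atLeastAtMost_Suc)

text \<open>Entries outside the index range are irrelevant, so removing the top summand keeps the
  same \<open>c\<close> and \<open>t\<close>, and only \<open>d\<close> and the sum change.\<close>

lemma macaulay_rep_induct [consumes 1, case_names single Suc]:
  assumes "macaulay_rep a d t c"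
    and "1 \<le> t \<Longrightarrow> t \<le> c t \<Longrightarrow> P (c t choose t) t"
    and "\<And>r d. macaulay_rep r d t c \<Longrightarrow> P r d \<Longrightarrow> t \<le> d \<Longrightarrow> c d < c (Suc d) \<Longrightarrow>
           P (r + (c (Suc d) choose Suc d)) (Suc d)"
  shows "P a d"
proof -
  have "t \<le> d" using assms(1) by (simp add: macaulay_rep_def)
  then show ?thesis using assms(1)
  proof (induction d arbitrary: a rule: dec_induct)
    case base
    then show ?case using assms(2) by (auto simp: macaulay_rep_single)
  next
    case (step d)
    then show ?case using assms(3) by (auto simp: macaulay_rep_Suc)
  qed
qed

section \<open>Uniqueness of the representation\<close>

lemma macaulay_rep_pos: "macaulay_rep a d t c \<Longrightarrow> 0 < a"
  by (induction rule: macaulay_rep_induct) auto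

text \<open>Pascal's rule absorbs the lower summands. With \<open>macaulay_rep_ge\<close>, this
  makes \<open>c d\<close> the greatest \<open>m\<close> with \<open>m choose d\<close> at most
  \<open>a\<close>.\<close>

lemma macaulay_rep_less: "macaulay_rep a d t c \<Longrightarrow> a < (c d + 1) choose d"
proof (induction rule: macaulay_rep_induct)
  case single
  then show ?case by (cases t) (auto simp: zero_less_binomial_iff)
next
  case (Suc r d)
  have "(c d + 1) choose d \<le> c (Suc d) choose d"
    using Suc by (intro binomial_right_mono) auto
  with Suc show ?case by simp
qed

lemma macaulay_rep_ge: "macaulay_rep a d t c \<Longrightarrow> c d choose d \<le> a"
  by (induction rule: macaulay_rep_induct) auto

lemma binomial_le_less_unique:
  fixes m n d :: nat
  assumes "m choose d \<le> a" "a < (m + 1) choose d" "n choose d \<le> a" "a < (n + 1) choose d"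
  shows "m = n"
proof (rule ccontr)
  assume "m \<noteq> n"
  then consider "m + 1 \<le> n" | "n + 1 \<le> m" by linarith
  then show False
    using assms binomial_right_mono[of "m + 1" n d] binomial_right_mono[of "n + 1" m d]
    by cases auto
qed

lemma macaulay_rep_unique:
  assumes "macaulay_rep a d t c" "macaulay_rep a d t' c'"
  shows "t = t' \<and> (\<forall>i\<in>{t..d}. c i = c' i)"
  using assms
proof (induction arbitrary: t' c' rule: macaulay_rep_induct)
  case single
  have rep: "macaulay_rep (c t choose t) t t c"
    using single by (simp add: macaulay_rep_single)
  have top: "c t = c' t"
    by (rule binomial_le_less_unique[OF macaulay_rep_ge[OF rep] macaulay_rep_less[OF rep]
          macaulay_rep_ge[OF single(3)] macaulay_rep_less[OF single(3)]])
  show ?case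
  proof (cases "t' = t")
    case False
    then obtain e where e: "t = Suc e" "t' \<le> e"
      using single(3) by (cases t) (auto simp: macaulay_rep_def)
    with single(3) obtain r where r: "macaulay_rep r e t' c'" "c t choose t = r + (c' t choose t)"
      by (auto simp: macaulay_rep_Suc)
    \<comment> \<open>Equal top entries would force \<open>r = 0\<close>, but a represented number
      is positive.\<close>
    with top macaulay_rep_pos[OF r(1)] show ?thesis by simp
  qed (use top in auto)
next
  case (Suc r d)
  let ?a = "r + (c (Suc d) choose Suc d)"
  have rep: "macaulay_rep ?a (Suc d) t c"
    using Suc.hyps by (auto simp: macaulay_rep_Suc)
  have top: "c (Suc d) = c' (Suc d)"
    by (rule binomial_le_less_unique[OF macaulay_rep_ge[OF rep] macaulay_rep_less[OF rep]
          macaulay_rep_ge[OF Suc.prems] macaulay_rep_less[OF Suc.prems]])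
  have "t' \<noteq> Suc d"
    using Suc.prems macaulay_rep_pos[OF Suc.hyps(1)] top
    by (auto simp: macaulay_rep_single simp del: binomial_Suc_Suc)
  then have "t' \<le> d"
    using Suc.prems by (simp add: macaulay_rep_def)
  with Suc.prems top have "macaulay_rep r d t' c'"
    by (auto simp: macaulay_rep_Suc)
  from Suc.IH[OF this] top show ?case
    by (auto simp: le_Suc_eq)
qed

section \<open>Existence by greedy choice\<close>

lemma binomial_greedy:
  assumes "0 < a" "1 \<le> d"
  obtains m :: nat where "d \<le> m" "m choose d \<le> a" "a < (m + 1) choose d"
proof -
  \<comment> \<open>\<open>GREATEST\<close> needs an upper bound on the candidates;
    \<open>d + a\<close> works because \<open>(d + a) choose d\<close> already exceeds
    \<open>a\<close>.\<close>
  have bound: "m \<le> d + a" if "m choose d \<le> a" for m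
  proof (rule ccontr)
    assume "\<not> m \<le> d + a"
    then have "(d + a) choose d \<le> m choose d"
      by (intro binomial_right_mono) simp
    have "a + 1 \<le> (d + a) choose d"
      using assms(2)
    proof (induction a)
      case (Suc a)
      then obtain e where "d = Suc e" by (cases d) auto
      then have "(d + Suc a) choose d = ((d + a) choose e) + ((d + a) choose d)"
        and "0 < (d + a) choose e"
        by (simp_all add: zero_less_binomial_iff)
      with Suc show ?case by linarith
    qed simp
    with \<open>(d + a) choose d \<le> m choose d\<close> that show False by simp
  qed
  define m where "m = (GREATEST m. m choose d \<le> a)"
  have d: "d choose d \<le> a" using assms by simp
  have "m choose d \<le> a" "d \<le> m"
    unfolding m_def
    using GreatestI_nat[of "\<lambda>m. m choose d \<le> a", OF d bound]
      Greatest_le_nat[of "\<lambda>m. m choose d \<le> a", OF d bound] by auto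
  moreover have "\<not> (m + 1) choose d \<le> a"
    using Greatest_le_nat[of "\<lambda>m. m choose d \<le> a", OF _ bound, of "m + 1"]
    unfolding m_def by fastforce
  ultimately show thesis using that by simp
qed

lemma macaulay_rep_exists:
  assumes "0 < a" "1 \<le> d"
  shows "\<exists>t c. macaulay_rep a d t c"
  using assms(2,1)
proof (induction d arbitrary: a rule: dec_induct)
  case base
  then show ?case
    by (intro exI[of _ 1] exI[of _ "\<lambda>_. a"]) (simp add: macaulay_rep_single)
next
  case (step d)
  obtain m where m: "Suc d \<le> m" "m choose Suc d \<le> a" "a < (m + 1) choose Suc d"
    using binomial_greedy[of a "Suc d"] step.prems by auto
  define r where "r = a - (m choose Suc d)"
  \<comment> \<open>By Pascal's rule, maximality of \<open>m\<close> says exactly that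
    \<open>r < m choose d\<close>; this forces the next entry below \<open>m\<close>.\<close>
  have a: "a = r + (m choose Suc d)" and r: "r < m choose d"
    using m by (auto simp: r_def)
  show ?case
  proof (cases "r = 0")
    case True
    then show ?thesis
      using m a by (intro exI[of _ "Suc d"] exI[of _ "\<lambda>_. m"]) (simp add: macaulay_rep_single)
  next
    case False
    with step.IH obtain t c where c: "macaulay_rep r d t c" by blast
    have "t \<le> d" using c by (simp add: macaulay_rep_def)
    have "c d < m"
      using macaulay_rep_ge[OF c] r binomial_right_mono[of m "c d" d] by linarith
    have "macaulay_rep r d t (c(Suc d := m))"
      using c by (auto simp: macaulay_rep_def strict_mono_on_def)
    with \<open>c d < m\<close> \<open>t \<le> d\<close> a have "macaulay_rep a (Suc d) t (c(Suc d := m))"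
      by (auto simp: macaulay_rep_Suc)
    then show ?thesis by blast
  qed
qed

section \<open>Evaluation of \<open>macaulay_up\<close>\<close>

lemma macaulay_up_eq:
  assumes "macaulay_rep a d t c"
  shows "macaulay_up a d = (\<Sum>i = t..d. (c i + 1) choose (i + 1))"
proof -
  have "(THE b. \<exists>t c. macaulay_rep a d t c \<and> b = (\<Sum>i = t..d. (c i + 1) choose (i + 1))) =
      (\<Sum>i = t..d. (c i + 1) choose (i + 1))"
  proof (rule the_equality)
    fix b assume "\<exists>t c. macaulay_rep a d t c \<and> b = (\<Sum>i = t..d. (c i + 1) choose (i + 1))"
    then obtain t' c' where c': "macaulay_rep a d t' c'"
      and b: "b = (\<Sum>i = t'..d. (c' i + 1) choose (i + 1))" by blast
    show "b = (\<Sum>i = t..d. (c i + 1) choose (i + 1))"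
      unfolding b using macaulay_rep_unique[OF assms c'] by (intro sum.cong) auto
  qed (use assms in blast)
  then show ?thesis
    using macaulay_rep_pos[OF assms] by (simp add: macaulay_up_def)
qed

lemma macaulay_up_Suc:
  assumes "macaulay_rep r d t c" "t \<le> d" "c d < c (Suc d)"
  shows "macaulay_up (r + (c (Suc d) choose Suc d)) (Suc d) =
    macaulay_up r d + ((c (Suc d) + 1) choose (Suc d + 1))"
proof -
  have "macaulay_rep (r + (c (Suc d) choose Suc d)) (Suc d) t c"
    using assms by (auto simp: macaulay_rep_Suc)
  from macaulay_up_eq[OF this] macaulay_up_eq[OF assms(1)] assms(2) show ?thesis
    by simp
qed

lemma macaulay_up_single:
  assumes "1 \<le> d" "d \<le> m"
  shows "macaulay_up (m choose d) d = (m + 1) choose (d + 1)"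
  using macaulay_up_eq[of "m choose d" d d "\<lambda>_. m"] assms by (simp add: macaulay_rep_single)

section \<open>Growth bounds for \<open>macaulay_up\<close>\<close>

lemma macaulay_up_le_add:
  "macaulay_rep a d t c \<Longrightarrow> macaulay_up a d \<le> a + ((c d + 1) choose (d + 1))"
proof (induction rule: macaulay_rep_induct)
  case single
  then show ?case by (simp add: macaulay_up_single)
next
  case (Suc r d)
  \<comment> \<open>The error term for \<open>r\<close> is at most the new summand, so it disappears
    into the new \<open>a\<close>.\<close>
  have "(c d + 1) choose (d + 1) \<le> c (Suc d) choose (d + 1)"
    using Suc by (intro binomial_right_mono) auto
  with Suc show ?case by (simp add: macaulay_up_Suc)
qed

lemma Suc_times_macaulay_up_single:
  assumes "1 \<le> d" "d \<le> m"
  shows "(d + 1) * macaulay_up (m choose d) d = (m + 1) * (m choose d)"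
  using Suc_times_binomial_eq[of m d] assms by (simp add: macaulay_up_single mult.commute)

lemma Suc_times_macaulay_up_le:
  "macaulay_rep a d t c \<Longrightarrow> (d + 1) * macaulay_up a d \<le> (c d + 2) * a"
proof (induction rule: macaulay_rep_induct)
  case single
  then show ?case
    using Suc_times_macaulay_up_single[of t "c t"] by simp
next
  case (Suc r d)
  define m where "m = c (Suc d)"
  define B where "B = m choose Suc d"
  define u where "u = macaulay_up r d"
  \<comment> \<open>Split \<open>(d + 2) * u\<close> into \<open>(d + 1) * u\<close>, at most
    \<open>(m + 1) * r\<close> by induction, and one more \<open>u\<close>, at most
    \<open>r + B\<close>. Adding \<open>(m + 1) * B\<close> from the top summand gives
    \<open>(m + 2) * (r + B)\<close>.\<close>
  have "u \<le> r + ((c d + 1) choose (d + 1))"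
    unfolding u_def by (rule macaulay_up_le_add) fact
  also have "(c d + 1) choose (d + 1) \<le> B"
    using Suc.hyps unfolding B_def m_def by (simp add: binomial_right_mono del: binomial_Suc_Suc)
  finally have "u \<le> r + B" by simp
  moreover have "(d + 1) * u \<le> (m + 1) * r"
    unfolding u_def m_def
    by (rule order.trans[OF Suc.IH mult_le_mono1]) (use Suc.hyps in simp)
  moreover have "(Suc d + 1) * ((m + 1) choose (Suc d + 1)) = (m + 1) * B"
    using Suc_times_binomial_eq[of m "Suc d"] by (simp add: B_def mult.commute del: binomial_Suc_Suc)
  moreover have "macaulay_up (r + B) (Suc d) = u + ((m + 1) choose (Suc d + 1))"
    using macaulay_up_Suc[OF Suc.hyps] by (simp only: m_def B_def u_def)
  ultimately show ?case
    unfolding m_def[symmetric] B_def[symmetric]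
    by (simp add: algebra_simps del: binomial_Suc_Suc)
qed

lemma Suc_times_macaulay_up_le':
  assumes d: "1 \<le> d" and a: "a \<le> (n + d - 1) choose d"
  shows "(d + 1) * macaulay_up a d \<le> (n + d) * a"
proof (cases "a = 0")
  case False
  then obtain t c where c: "macaulay_rep a d t c"
    using macaulay_rep_exists d by blast
  \<comment> \<open>Positivity excludes \<open>n = 0\<close>, where the binomial coefficient
    vanishes.\<close>
  have "0 < (n + d - 1) choose d" using False a by linarith
  then have n: "d \<le> n + d - 1" by (simp add: zero_less_binomial_iff)
  consider "c d + 2 \<le> n + d" | "n + d - 1 \<le> c d" using d by linarith
  then show ?thesis
  proof cases
    case 1
    then show ?thesis
      by (rule order.trans[OF Suc_times_macaulay_up_le[OF c] mult_le_mono1])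
  next
    case 2
    then have "a = (n + d - 1) choose d"
      using a macaulay_rep_ge[OF c] binomial_right_mono[OF 2, of d] by linarith
    then show ?thesis
      using Suc_times_macaulay_up_single[OF d n] d by simp
  qed
qed (simp add: macaulay_up_def)

section \<open>Application to O-sequences\<close>

lemma O_sequence_Suc_le:
  assumes "O_sequence h" "1 \<le> j" "h j \<le> (h 1 + j - 1) choose j"
  shows "(j + 1) * h (j + 1) \<le> (h 1 + j) * h j"
proof -
  have "h (j + 1) \<le> macaulay_up (h j) j"
    using assms(1,2) unfolding O_sequence_def by blast
  then have "(j + 1) * h (j + 1) \<le> (j + 1) * macaulay_up (h j) j"
    by (rule mult_le_mono2)
  also have "\<dots> \<le> (h 1 + j) * h j"
    by (rule Suc_times_macaulay_up_le') fact+
  finally show ?thesis .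
qed

lemma O_sequence_le_binomial:
  assumes "O_sequence h" "1 \<le> j"
  shows "h j \<le> (h 1 + j - 1) choose j"
  using assms(2)
proof (induction j rule: dec_induct)
  case (step j)
  have "(j + 1) * h (j + 1) \<le> (h 1 + j) * ((h 1 + j - 1) choose j)"
    by (rule order.trans[OF O_sequence_Suc_le[OF assms(1) step.hyps(1) step.IH] mult_le_mono2])
      (rule step.IH)
  \<comment> \<open>Absorption identity with top \<open>h 1 + j - 1\<close>; since
    \<open>1 \<le> j\<close>, the truncated subtraction is exact.\<close>
  also have "\<dots> = (j + 1) * ((h 1 + j) choose (j + 1))"
    using Suc_times_binomial_eq[of "h 1 + j - 1" j] step by (simp add: mult.commute)
  finally have "h (j + 1) \<le> (h 1 + j) choose (j + 1)"
    by (rule mult_left_le_imp_le) simp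
  then show ?case by simp
qed simp

theorem lemma3p11:
  fixes \<alpha> :: "nat \<Rightarrow> nat" and j :: nat
  assumes "O_sequence \<alpha>"
  shows "(\<alpha> 1 + j) * \<alpha> j \<ge> (j + 1) * \<alpha> (j + 1)"
proof (cases "j = 0")
  case True
  \<comment> \<open>The growth condition starts at index 1; here both sides equal
    \<open>\<alpha> 1\<close> because \<open>\<alpha> 0 = 1\<close>.\<close>
  then show ?thesis using assms by (simp add: O_sequence_def)
next
  case False
  then show ?thesis
    using O_sequence_Suc_le[OF assms] O_sequence_le_binomial[OF assms] by simp
qed

end
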